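(* Let $\mathcal{B}$ be an infinite complete ccc Boolean algebra of cardinality at most $\mathfrak{c}$. Then the following are equivalent: (i) every filter on $\mathcal{B}$ that has a base of cardinality smaller than $\mathfrak{c}$ can be extended to a coherent $P$-ultrafilter on $\mathcal{B}$; (ii) $\mathfrak{c} = \mathfrak{d}$.
   Context: $\mathfrak{c} = 2^{\aleph_0}$, and $\mathfrak{d}$ is the dominating number: the least cardinality of a family $D \subseteq \omega^\omega$ such that every $f \in \omega^\omega$ is eventually dominated by some $g \in D$ (i.e. $f(n) \le g(n)$ for all but finitely many $n$). Filters are proper. A base of a filter $\mathcal{F}$ on $\mathcal{B}$ is a subset of $\mathcal{F}$ such that every element of $\mathcal{F}$ is above some element of the subset. A partition of a Boolean algebra $\mathcal{B}$ is a maximal antichain, i.e. a maximal set of pairwise disjoint nonzero elements. In an infinite ccc algebra every infinite partition is countable, and is written $P = \{p_n : n \in \omega\}$ (enumerated without repetition). A $P$-ultrafilter on $\omega$ is an ultrafilter $\mathcal{V}$ on $\omega$ (principal ultrafilters allowed) such that for every partition $\{Q_n : n\in\omega\}$ of $\omega$ either $Q_n \in \mathcal{V}$ for some $n$, or there is $X \in \mathcal{V}$ with $X \cap Q_n$ finite for all $n$. An ultrafilter $\mathcal{U}$ on a complete ccc Boolean algebra $\mathcal{B}$ is a coherent $P$-ultrafilter if for every infinite partition $P = \{p_n : n\in\omega\}$ of $\mathcal{B}$, the family $\{A \subseteq \omega : \bigvee\{p_n : n \in A\} \in \mathcal{U}\}$ is a $P$-ultrafilter on $\omega$. *)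

theory Defs
  imports
    Main
    "HOL-Library.Countable_Set"
    "HOL-Library.Disjoint_Sets"
    "HOL-Library.Infinite_Set"
begin

unbundle cardinal_syntax

(* A complete Boolean algebra is a type of sort {boolean_algebra, complete_lattice}.  The library
   class complete_boolean_algebra must not be used for this purpose: it demands complete
   distributivity, so its instances are exactly the atomic complete Boolean algebras.  It is
   harmless that the type nat set, to which the notions below are also applied, is one of them. *)

section \<open>Cardinal characteristics\<close>

definition continuum :: "(nat \<Rightarrow> bool) rel" where
  "continuum = ctwo ^c natLeq"

definition dominating :: "(nat \<Rightarrow> nat) set \<Rightarrow> bool" where
  "dominating D \<longleftrightarrow> (\<forall>f. \<exists>g\<in>D. \<forall>\<^sub>\<infinity>n. f n \<le> g n)"

(* Determined up to =o, see dominating_number_least and dominating_number_attained. *)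
definition dominating_number :: "(nat \<Rightarrow> nat) rel" where
  "dominating_number =
     (SOME r. \<exists>D. dominating D \<and> r = |D| \<and> (\<forall>D'. dominating D' \<longrightarrow> |D| \<le>o |D'| ))"

lemma dominating_UNIV: "dominating UNIV"
  unfolding dominating_def by (metis UNIV_I MOST_I order_refl)

lemma dominating_number_spec:
  "\<exists>D. dominating D \<and> dominating_number = |D| \<and> (\<forall>D'. dominating D' \<longrightarrow> |D| \<le>o |D'| )"
proof -
  let ?R = "{ |D| | D. dominating D}"
  have "?R \<noteq> {}" and "\<forall>r\<in>?R. Card_order r"
    using dominating_UNIV by (auto simp: card_of_Card_order)
  then obtain r where "r \<in> ?R" and "\<forall>r'\<in>?R. r \<le>o r'"
    using exists_minim_Card_order[of ?R] by blast
  then have "\<exists>r D. dominating D \<and> r = |D| \<and> (\<forall>D'. dominating D' \<longrightarrow> |D| \<le>o |D'| )"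
    by blast
  then show ?thesis
    unfolding dominating_number_def by (rule someI_ex)
qed

lemma dominating_number_least: "dominating D \<Longrightarrow> dominating_number \<le>o |D|"
  using dominating_number_spec by auto

lemma dominating_number_attained: "\<exists>D. dominating D \<and> |D| =o dominating_number"
  using dominating_number_spec by (metis card_of_refl)


section \<open>Antichains, partitions and filters of a Boolean algebra\<close>

definition antichain :: "'a::boolean_algebra set \<Rightarrow> bool" where
  "antichain A \<longleftrightarrow> bot \<notin> A \<and> pairwise (\<lambda>x y. inf x y = bot) A"

definition ba_partition :: "'a::boolean_algebra set \<Rightarrow> bool" where
  "ba_partition P \<longleftrightarrow> antichain P \<and> (\<forall>A. antichain A \<and> P \<subseteq> A \<longrightarrow> A = P)"

definition ccc :: "'a::boolean_algebra itself \<Rightarrow> bool" where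
  "ccc _ \<longleftrightarrow> (\<forall>A::'a set. antichain A \<longrightarrow> countable A)"

definition ba_filter :: "'a::boolean_algebra set \<Rightarrow> bool" where
  "ba_filter F \<longleftrightarrow> top \<in> F \<and> bot \<notin> F \<and>
     (\<forall>x\<in>F. \<forall>y\<in>F. inf x y \<in> F) \<and> (\<forall>x\<in>F. \<forall>y. x \<le> y \<longrightarrow> y \<in> F)"

definition ba_ultrafilter :: "'a::boolean_algebra set \<Rightarrow> bool" where
  "ba_ultrafilter U \<longleftrightarrow> ba_filter U \<and> (\<forall>F. ba_filter F \<and> U \<subseteq> F \<longrightarrow> F = U)"

definition filter_base :: "'a::boolean_algebra set \<Rightarrow> 'a set \<Rightarrow> bool" where
  "filter_base D F \<longleftrightarrow> D \<subseteq> F \<and> (\<forall>x\<in>F. \<exists>d\<in>D. d \<le> x)"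


section \<open>P-ultrafilters\<close>

definition P_ultrafilter :: "nat set set \<Rightarrow> bool" where
  "P_ultrafilter V \<longleftrightarrow> ba_ultrafilter V \<and>
     (\<forall>Q :: nat \<Rightarrow> nat set. partition_on UNIV (range Q) \<longrightarrow>
        (\<exists>n. Q n \<in> V) \<or> (\<exists>X\<in>V. \<forall>n. finite (X \<inter> Q n)))"

(* The infinite partitions of a ccc algebra are exactly the sets range p for the sequences p
   considered here. *)
definition coherent_P_ultrafilter :: "'a::{boolean_algebra, complete_lattice} set \<Rightarrow> bool" where
  "coherent_P_ultrafilter U \<longleftrightarrow> ba_ultrafilter U \<and>
     (\<forall>p :: nat \<Rightarrow> 'a. inj p \<and> ba_partition (range p) \<longrightarrow>
        P_ultrafilter {A. Sup (p ` A) \<in> U})"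

end

theory Submission
  imports Defs
begin

text \<open>
  If \<open>\<cc> = \<dd>\<close>, the extension is built by deciding, one at a time, every pair consisting of
  an infinite partition \<open>p\<close> of the algebra and a partition \<open>Q\<close> of the natural numbers.  There are at
  most \<open>\<cc>\<close> such pairs, so along a well-order of minimal type fewer than \<open>\<cc>\<close> elements have been
  collected before each stage.  To decide \<open>(p, Q)\<close> is to add either some \<open>\<Squnion>{p n | n \<in> Q k}\<close>, or
  \<open>\<Squnion>{p n | n \<in> X}\<close> for an \<open>X\<close> that meets every \<open>Q k\<close> in a finite set.  If no block \<open>Q k\<close> can be
  added, every finite meet of collected elements meets pieces \<open>p n\<close> in blocks of arbitrarily large
  index.  The places where this happens give one function for each finite meet; these are fewer than
  \<open>\<dd>\<close> functions, so they do not dominate, and a function that escapes them all bounds an \<open>X\<close> that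
  can be added (lemma \<open>fip_extends_deciding\<close>).  Having decided a pair survives any enlargement, so
  every ultrafilter above the collected elements is a coherent P-ultrafilter
  (\<open>fip_extends_to_coherent_P_ultrafilter\<close>).

  Conversely, suppose that some dominating family \<open>D\<close> is smaller than \<open>\<cc>\<close>.  View the natural
  numbers as the plane of pairs \<open>(k, j)\<close>, partitioned into its columns.  The regions
  \<open>{(k, j) | m \<le> k \<and> g k < j}\<close> with \<open>g \<in> D\<close> form a base of a filter.  An ultrafilter containing
  them all contains no column, and no set with finite columns either, because the function bounding
  such a set is dominated by some \<open>g \<in> D\<close> (\<open>no_P_ultrafilter_contains_regions\<close>).  Carried into
  the algebra along an infinite partition, this filter has a base of size less than \<open>\<cc>\<close> but no
  extension to a coherent P-ultrafilter (\<open>small_dominating_family_blocks_extension\<close>).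
\<close>

section \<open>Cardinalities\<close>

lemma continuum_eq_card_sets: "continuum =o |UNIV :: nat set set|"
proof -
  have "|Pow (UNIV :: nat set)| =o |Func (UNIV :: nat set) (UNIV :: bool set)|"
    by (rule card_of_Pow_Func)
  then show ?thesis
    unfolding continuum_def cexp_def ctwo_def Field_card_of Field_natLeq Pow_UNIV
    by (rule ordIso_symmetric)
qed

lemma Card_order_continuum: "Card_order continuum"
  unfolding continuum_def by (rule Card_order_cexp)

lemma natLeq_less_continuum: "natLeq <o continuum"
  unfolding continuum_def by (intro ordLess_ctwo_cexp natLeq_Card_order)

lemma infinite_Field_continuum: "infinite (Field continuum)"
  using natLeq_less_continuum
  by (metis Field_natLeq card_of_mono2 card_of_ordLeq_finite infinite_UNIV_nat ordLess_imp_ordLeq)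

lemma finite_less_continuum: "finite A \<Longrightarrow> |A| <o continuum"
  using infinite_Field_continuum Card_order_continuum
  by (intro finite_ordLess_infinite card_of_Well_order) (auto simp: Field_card_of card_order_on_def)

lemma leq_continuumI: "inj_on (f :: 'b \<Rightarrow> nat set) A \<Longrightarrow> |A| \<le>o continuum"
  using continuum_eq_card_sets card_of_ordLeq[of A "UNIV :: nat set set"]
  by (metis ordIso_symmetric ordLeq_ordIso_trans subset_UNIV)

lemma card_Fpow_le:
  assumes "infinite S"
  shows "|Fpow S| \<le>o |S|"
proof -
  \<comment> \<open>Sets of size \<open>n + 1\<close> arise from one element and a set of size \<open>n\<close>.\<close>
  let ?A = "\<lambda>n. {T \<in> Fpow S. card T = n}"
  have "|?A n| \<le>o |S|" for n
  proof (induction n)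
    case 0
    have "?A 0 \<subseteq> {{}}"
      by (auto simp: Fpow_def)
    then have "finite (?A 0)"
      by (rule finite_subset) simp
    then show ?case
      using assms by (intro ordLess_imp_ordLeq finite_ordLess_infinite card_of_Well_order)
        (auto simp: Field_card_of)
  next
    case (Suc n)
    have "?A (Suc n) \<subseteq> (\<lambda>(x, T). insert x T) ` (S \<times> ?A n)"
    proof
      fix T assume "T \<in> ?A (Suc n)"
      then have T: "T \<subseteq> S" "finite T" "card T = Suc n"
        by (auto simp: Fpow_def)
      then obtain x T' where "T = insert x T'" "x \<notin> T'" "card T' = n" "finite T'"
        by (metis card_Suc_eq_finite)
      then show "T \<in> (\<lambda>(x, T). insert x T) ` (S \<times> ?A n)"
        using T by (auto simp: Fpow_def)
    qed
    then have "|?A (Suc n)| \<le>o |S \<times> ?A n|"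
      using card_of_mono1 card_of_image ordLeq_transitive by blast
    also have "|S \<times> ?A n| \<le>o |S \<times> S|"
      using Suc.IH by (rule card_of_Times_mono2)
    also have "|S \<times> S| =o |S|"
      using assms by (rule card_of_Times_same_infinite)
    finally show ?case .
  qed
  then have "|\<Union>n. ?A n| \<le>o |S|"
    using assms infinite_iff_card_of_nat by (intro card_of_UNION_ordLeq_infinite) auto
  moreover have "(\<Union>n. ?A n) = Fpow S"
    by auto
  ultimately show ?thesis
    by simp
qed

lemma Fpow_less_continuum:
  assumes "|S| <o continuum"
  shows "|Fpow S| <o continuum"
proof (cases "finite S")
  case True
  then have "finite (Fpow S)"
    by (simp add: Fpow_Pow_finite)
  then show ?thesis
    by (rule finite_less_continuum)
next
  case False
  then show ?thesis
    using assms card_Fpow_le ordLeq_ordLess_trans by blast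
qed

lemma nat_Times_less_continuum:
  assumes "|D| <o continuum"
  shows "|(UNIV :: nat set) \<times> D| <o continuum"
proof -
  \<comment> \<open>Passing to the disjoint sum makes the cardinal infinite, so that it equals its square.\<close>
  let ?E = "(UNIV :: nat set) <+> D"
  have "|UNIV :: nat set| <o continuum"
    using natLeq_less_continuum card_of_nat ordIso_ordLess_trans by blast
  then have "|?E| <o continuum"
    using assms infinite_Field_continuum Card_order_continuum
    by (intro card_of_Plus_ordLess_infinite_Field)
  moreover have "|(UNIV :: nat set) \<times> D| \<le>o |?E \<times> ?E|"
    using card_of_Times_mono1[OF card_of_Plus1] card_of_Times_mono2[OF card_of_Plus2]
      ordLeq_transitive by blast
  moreover have "|?E \<times> ?E| =o |?E|"
    by (rule card_of_Times_same_infinite) simp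
  ultimately show ?thesis
    using ordLeq_ordIso_trans ordLeq_ordLess_trans by blast
qed

lemma dominating_number_le_continuum: "dominating_number \<le>o continuum"
proof -
  let ?graph = "\<lambda>f :: nat \<Rightarrow> nat. (\<lambda>n. prod_encode (n, f n)) ` UNIV"
  have "inj ?graph"
  proof (rule injI, rule ext)
    fix f g n assume "?graph f = ?graph g"
    then have "prod_encode (n, f n) \<in> ?graph g"
      by blast
    then show "f n = g n"
      by (auto simp: prod_encode_eq)
  qed
  then show ?thesis
    using dominating_number_least[OF dominating_UNIV] leq_continuumI ordLeq_transitive by blast
qed

text \<open>
  The cardinal \<open>\<cc>\<close> equals \<open>\<cc>\<close> to the power \<open>\<aleph>\<^sub>0\<close>.  This bounds the number of tasks in the
  transfinite construction below.
\<close>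

lemma card_sequence_pairs_le_continuum:
  assumes "|UNIV :: 'a set| \<le>o continuum"
  shows "|UNIV :: ((nat \<Rightarrow> 'a) \<times> (nat \<Rightarrow> nat set)) set| \<le>o continuum"
proof -
  have "|UNIV :: 'a set| \<le>o |UNIV :: nat set set|"
    using assms continuum_eq_card_sets by (rule ordLeq_ordIso_trans)
  then obtain e :: "'a \<Rightarrow> nat set" where e: "inj e"
    using card_of_ordLeq[of "UNIV :: 'a set" "UNIV :: nat set set"] by auto
  \<comment> \<open>The codes of the sets \<open>e (p i)\<close> and \<open>Q i\<close> are interleaved on even and odd numbers.\<close>
  define code :: "(nat \<Rightarrow> 'a) \<times> (nat \<Rightarrow> nat set) \<Rightarrow> nat set" where
    "code = (\<lambda>(p, Q). {n. case prod_decode n of (i, j) \<Rightarrow>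
               if even j then j div 2 \<in> e (p i) else j div 2 \<in> Q i})"
  have even: "prod_encode (i, 2 * j) \<in> code (p, Q) \<longleftrightarrow> j \<in> e (p i)"
    and odd: "prod_encode (i, Suc (2 * j)) \<in> code (p, Q) \<longleftrightarrow> j \<in> Q i" for p Q i j
    by (simp_all add: code_def)
  have "inj code"
  proof (rule injI, clarify)
    fix p Q p' Q' assume eq: "code (p, Q) = code (p', Q')"
    then have "e (p i) = e (p' i)" and "Q i = Q' i" for i
      using even odd by blast+
    then show "p = p' \<and> Q = Q'"
      using e by (auto simp: inj_eq)
  qed
  then show ?thesis
    by (rule leq_continuumI)
qed


section \<open>Partitions of a complete Boolean algebra\<close>

text \<open>
  Complements turn disjointness into an order relation, and this replaces the infinite
  distributive law.
\<close>

lemma inf_Sup_eq_bot: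
  fixes x :: "'a::{boolean_algebra, complete_lattice}"
  assumes "\<And>y. y \<in> Y \<Longrightarrow> inf x y = bot"
  shows "inf x (Sup Y) = bot"
proof -
  have "Sup Y \<le> - x"
    using assms by (intro Sup_least) (metis inf.commute inf_shunt)
  then show ?thesis
    by (metis inf.commute inf_shunt)
qed

lemma Sup_partition:
  fixes P :: "'a::{boolean_algebra, complete_lattice} set"
  assumes "ba_partition P"
  shows "Sup P = top"
proof (rule ccontr)
  assume ne: "Sup P \<noteq> top"
  have disj: "inf (- Sup P) y = bot" if "y \<in> P" for y
    using that Sup_upper[of y P] by (metis compl_le_compl_iff double_compl inf.commute inf_shunt)
  have "- Sup P \<noteq> bot"
    using ne by (metis compl_bot_eq double_compl)
  then have "antichain (insert (- Sup P) P)"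
    using assms disj unfolding ba_partition_def antichain_def pairwise_insert
    by (auto simp: inf.commute)
  then have "- Sup P \<in> P"
    using assms unfolding ba_partition_def by blast
  then show False
    using disj \<open>- Sup P \<noteq> bot\<close> by fastforce
qed

lemma ba_partitionI:
  fixes P :: "'a::{boolean_algebra, complete_lattice} set"
  assumes "antichain P" "Sup P = top"
  shows "ba_partition P"
  unfolding ba_partition_def
proof (intro conjI allI impI)
  fix A assume A: "antichain A \<and> P \<subseteq> A"
  have "a \<in> P" if "a \<in> A" for a
  proof (rule ccontr)
    assume "a \<notin> P"
    have "inf a y = bot" if "y \<in> P" for y
    proof -
      have "pairwise (\<lambda>x y. inf x y = bot) A" "y \<in> A" "a \<noteq> y"
        using A that \<open>a \<notin> P\<close> by (auto simp: antichain_def)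
      then show ?thesis
        using \<open>a \<in> A\<close> by (auto dest: pairwiseD)
    qed
    then have "inf a (Sup P) = bot"
      by (rule inf_Sup_eq_bot)
    then show False
      using A \<open>a \<in> A\<close> assms by (auto simp: antichain_def)
  qed
  then show "A = P"
    using A by blast
qed fact

text \<open>
  Together with the next lemma: joining the pieces of a partition is a Boolean homomorphism from
  sets of indices into the algebra, so it pulls ultrafilters back to ultrafilters.
\<close>

lemma Sup_partition_Compl:
  fixes p :: "nat \<Rightarrow> 'a::{boolean_algebra, complete_lattice}"
  assumes "inj p" "ba_partition (range p)"
  shows "Sup (p ` (- A)) = - Sup (p ` A)"
proof (rule sym, rule compl_unique)
  have "inf (p m) (p n) = bot" if "m \<in> A" "n \<in> - A" for m n
  proof -
    have "p m \<noteq> p n"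
      using that assms(1) by (auto simp: inj_eq)
    then show ?thesis
      using assms(2) unfolding ba_partition_def antichain_def pairwise_def by blast
  qed
  then have "inf (p m) (Sup (p ` (- A))) = bot" if "m \<in> A" for m
    using that by (intro inf_Sup_eq_bot) blast
  then show "inf (Sup (p ` A)) (Sup (p ` (- A))) = bot"
    by (subst inf.commute, intro inf_Sup_eq_bot) (auto simp: inf.commute)
  have "sup (Sup (p ` A)) (Sup (p ` (- A))) = Sup (p ` A \<union> p ` (- A))"
    by (rule Sup_union_distrib[symmetric])
  also have "p ` A \<union> p ` (- A) = range p"
    by blast
  finally show "sup (Sup (p ` A)) (Sup (p ` (- A))) = top"
    using Sup_partition[OF assms(2)] by simp
qed

lemma Sup_partition_Int:
  fixes p :: "nat \<Rightarrow> 'a::{boolean_algebra, complete_lattice}"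
  assumes "inj p" "ba_partition (range p)"
  shows "Sup (p ` (A \<inter> B)) = inf (Sup (p ` A)) (Sup (p ` B))"
proof -
  have "- Sup (p ` (A \<inter> B)) = Sup (p ` (- A \<union> - B))"
    using Sup_partition_Compl[OF assms, of "A \<inter> B"] by simp
  also have "\<dots> = sup (- Sup (p ` A)) (- Sup (p ` B))"
    by (simp only: image_Un Sup_union_distrib Sup_partition_Compl[OF assms])
  finally show ?thesis
    by (metis compl_inf double_compl)
qed

text \<open>
  An element with infinitely many elements below it can be split into two parts, one of which
  again has infinitely many elements below it, since \<open>x \<le> a\<close> is determined by its meets with the
  two parts.
\<close>

lemma infinite_below_cases:
  fixes a :: "'a::boolean_algebra"
  assumes "infinite {x. x \<le> a}"
  shows "\<exists>b\<le>a. b \<noteq> bot \<and> infinite {x. x \<le> inf a (- b)}"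
proof -
  have "\<not> {x. x \<le> a} \<subseteq> {bot, a}"
    using assms finite_subset by blast
  then obtain b where b: "b \<le> a" "b \<noteq> bot" "b \<noteq> a"
    by blast
  define c where "c = inf a (- b)"
  have c: "c \<le> a" "c \<noteq> bot" "inf a (- c) = b"
  proof -
    show "c \<le> a"
      by (simp add: c_def)
    show "c \<noteq> bot"
      using b unfolding c_def by (metis double_compl inf_shunt order_antisym)
    show "inf a (- c) = b"
      using b(1) by (simp add: c_def compl_inf inf_sup_distrib1 inf.absorb2)
  qed
  have "inj_on (\<lambda>x. (inf x b, inf x c)) {x. x \<le> a}"
  proof (rule inj_onI)
    have split: "x = sup (inf x b) (inf x c)" if "x \<le> a" for x
    proof -
      have "sup b c = a"
        using b(1) by (simp add: c_def sup_inf_distrib1 sup.absorb2)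
      then show ?thesis
        using that by (simp add: inf_sup_distrib1[symmetric] inf.absorb1)
    qed
    fix x y assume "x \<in> {x. x \<le> a}" "y \<in> {x. x \<le> a}" "(inf x b, inf x c) = (inf y b, inf y c)"
    then show "x = y"
      using split[of x] split[of y] by simp
  qed
  moreover have "(\<lambda>x. (inf x b, inf x c)) ` {x. x \<le> a} \<subseteq> {x. x \<le> b} \<times> {x. x \<le> c}"
    by auto
  ultimately have "infinite ({x. x \<le> b} \<times> {x. x \<le> c})"
    using assms by (meson finite_subset finite_imageD)
  then have "infinite {x. x \<le> b} \<or> infinite {x. x \<le> c}"
    by auto
  then show ?thesis
  proof
    assume "infinite {x. x \<le> b}"
    then show ?thesis
      using c by (intro exI[of _ c]) simp
  next
    assume "infinite {x. x \<le> c}"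
    then show ?thesis
      using b by (intro exI[of _ b]) (simp add: c_def)
  qed
qed

lemma infinite_disjoint_sequence:
  assumes "infinite (UNIV :: 'a::boolean_algebra set)"
  shows "\<exists>b :: nat \<Rightarrow> 'a. (\<forall>n. b n \<noteq> bot) \<and> (\<forall>m n. m \<noteq> n \<longrightarrow> inf (b m) (b n) = bot)"
proof -
  have "\<exists>a :: nat \<Rightarrow> 'a. \<forall>n. infinite {x. x \<le> a n} \<and>
          (\<exists>b\<le>a n. b \<noteq> bot \<and> a (Suc n) = inf (a n) (- b))"
  proof (rule dependent_nat_choice)
    show "\<exists>x :: 'a. infinite {y. y \<le> x}"
      using assms by (intro exI[of _ top]) simp
  next
    fix x :: 'a assume "infinite {y. y \<le> x}"
    then show "\<exists>y. infinite {z. z \<le> y} \<and> (\<exists>b\<le>x. b \<noteq> bot \<and> y = inf x (- b))"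
      using infinite_below_cases by metis
  qed
  then obtain a b :: "nat \<Rightarrow> 'a" where
    b: "\<And>n. b n \<le> a n" "\<And>n. b n \<noteq> bot" and a: "\<And>n. a (Suc n) = inf (a n) (- b n)"
    by metis
  have antimono: "a n \<le> a m" if "m \<le> n" for m n
    using that by (rule lift_Suc_antimono_le[rotated]) (simp add: a)
  have less: "inf (b m) (b n) = bot" if "m < n" for m n
  proof -
    have "b n \<le> a (Suc m)"
      using antimono[OF Suc_leI[OF that]] b(1)[of n] by (rule order_trans[rotated])
    then have "b n \<le> - b m"
      by (simp add: a)
    then show ?thesis
      by (metis inf.commute inf_shunt)
  qed
  then have "inf (b m) (b n) = bot" if "m \<noteq> n" for m n
    using that by (metis inf.commute nat_neq_iff)
  then show ?thesis
    using b(2) by blast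
qed

text \<open>
  A sequence of disjoint nonzero elements becomes a partition once its first member absorbs
  everything that lies outside the others.
\<close>

lemma exists_infinite_partition:
  assumes "infinite (UNIV :: 'a::{boolean_algebra, complete_lattice} set)"
  shows "\<exists>p :: nat \<Rightarrow> 'a. inj p \<and> ba_partition (range p)"
proof -
  obtain b :: "nat \<Rightarrow> 'a" where b: "\<And>n. b n \<noteq> bot" "\<And>m n. m \<noteq> n \<Longrightarrow> inf (b m) (b n) = bot"
    using infinite_disjoint_sequence[OF assms] by blast
  define p where "p = b(0 := - Sup (b ` {0<..}))"
  have b0: "b 0 \<le> p 0"
  proof -
    have "inf (b 0) (Sup (b ` {0<..})) = bot"
      using b(2) by (intro inf_Sup_eq_bot) auto
    then show ?thesis
      by (simp add: p_def inf_shunt)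
  qed
  have nonzero: "p n \<noteq> bot" for n
    using b(1) b0 by (cases "n = 0") (metis le_bot, simp add: p_def)
  have p0: "inf (p 0) (p n) = bot" if "n > 0" for n
    using that Sup_upper[of "b n" "b ` {0<..}"] by (simp add: p_def inf_shunt)
  have disjoint: "inf (p m) (p n) = bot" if "m \<noteq> n" for m n
  proof (cases "m = 0 \<or> n = 0")
    case True
    then show ?thesis
      using p0 that by (metis gr0I inf.commute)
  next
    case False
    then show ?thesis
      using b(2) that by (simp add: p_def)
  qed
  have "inj p"
    using disjoint nonzero by (metis injI inf.idem)
  moreover have "ba_partition (range p)"
  proof (rule ba_partitionI)
    show "antichain (range p)"
      using disjoint nonzero unfolding antichain_def pairwise_def by (metis imageE)
    have "Sup (b ` {0<..}) \<le> Sup (range p)"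
      by (rule Sup_subset_mono) (auto simp: p_def)
    then have "- p 0 \<le> Sup (range p)"
      by (simp add: p_def)
    moreover have "p 0 \<le> Sup (range p)"
      by (simp add: Sup_upper)
    ultimately show "Sup (range p) = top"
      by (metis le_sup_iff sup_compl_top top_le)
  qed
  ultimately show ?thesis
    by blast
qed


section \<open>The finite intersection property and ultrafilters\<close>

definition fip :: "'a::{boolean_algebra, complete_lattice} set \<Rightarrow> bool" where
  "fip S \<longleftrightarrow> (\<forall>T\<in>Fpow S. Inf T \<noteq> bot)"

lemma fip_subset: "fip S \<Longrightarrow> T \<subseteq> S \<Longrightarrow> fip T"
  unfolding fip_def using Fpow_mono by blast

text \<open>
  A finite subset of \<open>insert x S\<close> has a meet above \<open>inf (Inf T) x\<close> for the part \<open>T\<close> of it that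
  lies in \<open>S\<close>.
\<close>

lemma fip_insertI:
  assumes "\<And>T. T \<in> Fpow S \<Longrightarrow> inf (Inf T) x \<noteq> bot"
  shows "fip (insert x S)"
  unfolding fip_def
proof
  fix T assume T: "T \<in> Fpow (insert x S)"
  have "T - {x} \<in> Fpow S"
    using T by (auto simp: Fpow_def)
  moreover have "inf (Inf (T - {x})) x \<le> Inf T"
    by (intro Inf_greatest) (auto intro: le_infI1 le_infI2 Inf_lower)
  ultimately show "Inf T \<noteq> bot"
    using assms le_bot by metis
qed

lemma ba_filter_Inf:
  fixes F :: "'a::{boolean_algebra, complete_lattice} set"
  assumes "ba_filter F" "T \<in> Fpow F"
  shows "Inf T \<in> F"
proof -
  have "finite T" "T \<subseteq> F"
    using assms(2) by (auto simp: Fpow_def)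
  then show ?thesis
    using assms(1) by induction (auto simp: ba_filter_def)
qed

lemma fip_ba_filter: "ba_filter F \<Longrightarrow> fip F"
  unfolding fip_def using ba_filter_Inf by (metis ba_filter_def)

lemma fip_generates_filter:
  assumes "fip S"
  shows "\<exists>F. ba_filter F \<and> S \<subseteq> F"
proof (intro exI conjI)
  let ?F = "{y. \<exists>T\<in>Fpow S. Inf T \<le> y}"
  show "S \<subseteq> ?F"
  proof
    fix x assume "x \<in> S"
    then have "{x} \<in> Fpow S" and "Inf {x} \<le> x"
      by (auto simp: Fpow_def)
    then show "x \<in> ?F"
      by blast
  qed
  have "inf x y \<in> ?F" if xy: "x \<in> ?F" "y \<in> ?F" for x y
  proof -
    obtain T T' where "T \<in> Fpow S" "T' \<in> Fpow S" "Inf T \<le> x" "Inf T' \<le> y"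
      using xy by blast
    then have "T \<union> T' \<in> Fpow S" "Inf (T \<union> T') \<le> inf x y"
      by (auto simp: Fpow_def Inf_union_distrib intro: le_infI1 le_infI2)
    then show ?thesis
      by blast
  qed
  moreover have "bot \<notin> ?F"
    using assms le_bot by (auto simp: fip_def)
  moreover have "top \<in> ?F"
    using empty_in_Fpow by auto
  ultimately show "ba_filter ?F"
    unfolding ba_filter_def by (blast intro: order_trans)
qed

lemma filter_extends_to_ultrafilter:
  assumes "ba_filter F"
  shows "\<exists>U. ba_ultrafilter U \<and> F \<subseteq> U"
proof -
  let ?A = "{G. ba_filter G \<and> F \<subseteq> G}"
  have "\<exists>U\<in>?A. \<forall>G\<in>?A. U \<subseteq> G \<longrightarrow> G = U"
  proof (rule subset_Zorn_nonempty)
    show "?A \<noteq> {}"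
      using assms by blast
    fix C assume "C \<noteq> {}" and C: "subset.chain ?A C"
    then obtain G where G: "G \<in> C"
      by blast
    have filters: "ba_filter H" "F \<subseteq> H" if "H \<in> C" for H
      using C that by (auto simp: subset.chain_def)
    have "inf x y \<in> \<Union>C" if xy: "x \<in> \<Union>C" "y \<in> \<Union>C" for x y
    proof -
      obtain H K where HK: "H \<in> C" "K \<in> C" "x \<in> H" "y \<in> K"
        using xy by blast
      then have "H \<subseteq> K \<or> K \<subseteq> H"
        using C by (auto simp: subset_chain_def)
      then obtain L where "L \<in> C" "x \<in> L" "y \<in> L"
        using HK by blast
      then show ?thesis
        using filters unfolding ba_filter_def by blast
    qed
    moreover have "top \<in> \<Union>C" "bot \<notin> \<Union>C"
      using filters G unfolding ba_filter_def by blast+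
    moreover have "y \<in> \<Union>C" if "x \<in> \<Union>C" "x \<le> y" for x y
      using filters that unfolding ba_filter_def by blast
    ultimately have "ba_filter (\<Union>C)"
      unfolding ba_filter_def by (intro conjI ballI allI impI)
    moreover have "F \<subseteq> \<Union>C"
      using filters(2)[OF G] G by blast
    ultimately show "\<Union>C \<in> ?A"
      by blast
  qed
  then obtain U where U: "ba_filter U" "F \<subseteq> U"
    and max: "\<And>G. ba_filter G \<Longrightarrow> F \<subseteq> G \<Longrightarrow> U \<subseteq> G \<Longrightarrow> G = U"
    by auto
  then have "ba_ultrafilter U"
    unfolding ba_ultrafilter_def by (metis order_trans)
  then show ?thesis
    using U(2) by blast
qed

lemma fip_extends_to_ultrafilter:
  assumes "fip S"
  shows "\<exists>U. ba_ultrafilter U \<and> S \<subseteq> U"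
proof -
  obtain F where "ba_filter F" "S \<subseteq> F"
    using fip_generates_filter[OF assms] by blast
  then show ?thesis
    using filter_extends_to_ultrafilter[of F] by (meson order_trans)
qed

text \<open>
  If \<open>- x \<notin> U\<close>, every element of \<open>U\<close> meets \<open>x\<close>, so \<open>x\<close> can be added, and maximality says that
  it was there already.
\<close>

lemma ba_ultrafilter_Compl:
  fixes U :: "'a::{boolean_algebra, complete_lattice} set"
  assumes U: "ba_ultrafilter U" and "- x \<notin> U"
  shows "x \<in> U"
proof -
  have F: "ba_filter U"
    using U by (simp add: ba_ultrafilter_def)
  have "fip (insert x U)"
  proof (rule fip_insertI)
    fix T assume "T \<in> Fpow U"
    then have "Inf T \<in> U"
      using F ba_filter_Inf by blast
    then show "inf (Inf T) x \<noteq> bot"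
      using F assms(2) unfolding ba_filter_def inf_shunt by blast
  qed
  then obtain G where "ba_filter G" "insert x U \<subseteq> G"
    using fip_generates_filter by blast
  then show ?thesis
    using U unfolding ba_ultrafilter_def by blast
qed

lemma ba_ultrafilterI:
  assumes V: "ba_filter V" and "\<And>x. x \<in> V \<or> - x \<in> V"
  shows "ba_ultrafilter V"
  unfolding ba_ultrafilter_def
proof (intro conjI allI impI)
  fix G assume G: "ba_filter G \<and> V \<subseteq> G"
  have "x \<in> V" if "x \<in> G" for x
  proof (rule ccontr)
    assume "x \<notin> V"
    then have "- x \<in> G"
      using assms(2) G by blast
    then have "inf x (- x) \<in> G"
      using G that unfolding ba_filter_def by blast
    then show False
      using G by (simp add: ba_filter_def)
  qed
  then show "G = V"
    using G by blast
qed fact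

lemma ba_ultrafilter_partition_trace:
  fixes p :: "nat \<Rightarrow> 'a::{boolean_algebra, complete_lattice}"
  assumes U: "ba_ultrafilter U" and p: "inj p" "ba_partition (range p)"
  shows "ba_ultrafilter {A. Sup (p ` A) \<in> U}"
proof (rule ba_ultrafilterI)
  have F: "ba_filter U"
    using U by (simp add: ba_ultrafilter_def)
  then have up: "y \<in> U" if "x \<in> U" "x \<le> y" for x y
    using that unfolding ba_filter_def by blast
  show "ba_filter {A. Sup (p ` A) \<in> U}"
    unfolding ba_filter_def
  proof (intro conjI ballI allI impI)
    show "top \<in> {A. Sup (p ` A) \<in> U}" "bot \<notin> {A. Sup (p ` A) \<in> U}"
      using F Sup_partition[OF p(2)] by (auto simp: ba_filter_def)
    show "inf A B \<in> {A. Sup (p ` A) \<in> U}"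
      if "A \<in> {A. Sup (p ` A) \<in> U}" "B \<in> {A. Sup (p ` A) \<in> U}" for A B
      using that F by (simp add: Sup_partition_Int[OF p] ba_filter_def)
    show "B \<in> {A. Sup (p ` A) \<in> U}" if "A \<in> {A. Sup (p ` A) \<in> U}" "A \<le> B" for A B
      using that by (auto intro: up Sup_subset_mono image_mono)
  qed
  show "A \<in> {A. Sup (p ` A) \<in> U} \<or> - A \<in> {A. Sup (p ` A) \<in> U}" for A
    using ba_ultrafilter_Compl[OF U] Sup_partition_Compl[OF p, of A] by auto
qed


section \<open>Extending filters when the dominating number is the continuum\<close>

text \<open>
  An ultrafilter that contains an element deciding \<open>p\<close> and \<open>Q\<close> satisfies the P-point condition
  for its trace on \<open>p\<close> at the partition \<open>Q\<close>.  Membership of a single element is preserved by all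
  enlargements, so the tasks can be handled independently of each other.
\<close>

definition decides :: "(nat \<Rightarrow> 'a::{boolean_algebra, complete_lattice}) \<Rightarrow> (nat \<Rightarrow> nat set) \<Rightarrow> 'a \<Rightarrow> bool"
  where "decides p Q x \<longleftrightarrow>
    (\<exists>k. x = Sup (p ` Q k)) \<or> (\<exists>X. x = Sup (p ` X) \<and> (\<forall>k. finite (X \<inter> Q k)))"

text \<open>
  The step where the dominating number enters.  Suppose that no \<open>Sup (p ` Q k)\<close> can be added, and
  let \<open>c n\<close> be the index of the block of \<open>n\<close>.  A finite meet of elements of \<open>S\<close> cannot live on
  finitely many blocks, as each block is already excluded by some finite meet.  So for each finite
  \<open>T\<close> and each \<open>m\<close> there is \<open>n = h T m\<close> with \<open>m \<le> c n\<close> whose piece meets \<open>Inf T\<close>.  The functions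
  \<open>h T\<close> are too few to dominate; a function \<open>f\<close> exceeding each of them somewhere yields, after
  being made monotone, a set with finite intersections with all blocks whose join meets every
  \<open>Inf T\<close>.
\<close>

lemma fip_extends_deciding:
  fixes p :: "nat \<Rightarrow> 'a::{boolean_algebra, complete_lattice}"
  assumes S: "fip S" "|Fpow S| <o dominating_number"
    and p: "ba_partition (range p)" and Q: "partition_on UNIV (range Q)"
  shows "\<exists>x. decides p Q x \<and> fip (insert x S)"
proof (cases "\<exists>k. fip (insert (Sup (p ` Q k)) S)")
  case True
  then show ?thesis
    unfolding decides_def by blast
next
  case False
  then have "\<exists>T\<in>Fpow S. inf (Inf T) (Sup (p ` Q k)) = bot" for k
    using fip_insertI by metis
  then obtain N where N: "\<And>k. N k \<in> Fpow S" "\<And>k. inf (Inf (N k)) (Sup (p ` Q k)) = bot"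
    by metis
  \<comment> \<open>The sequence \<open>Q\<close> may list a block several times; the least index makes \<open>c\<close> constant on blocks.\<close>
  define c where "c n = (LEAST k. n \<in> Q k)" for n
  have "\<exists>k. n \<in> Q k" for n
    using Q unfolding partition_on_def by blast
  then have c: "n \<in> Q (c n)" for n
    unfolding c_def by (rule LeastI_ex)
  have "\<exists>n. m \<le> c n \<and> inf (Inf T) (p n) \<noteq> bot" if T: "T \<in> Fpow S" for T m
  proof (rule ccontr)
    assume none: "\<nexists>n. m \<le> c n \<and> inf (Inf T) (p n) \<noteq> bot"
    \<comment> \<open>Otherwise this finite meet is disjoint from all pieces, hence from \<open>top\<close>.\<close>
    let ?W = "T \<union> (\<Union>k<m. N k)"
    have "?W \<in> Fpow S"
      using T N(1) by (auto simp: Fpow_def)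
    have "inf (Inf ?W) (p n) = bot" for n
    proof (cases "m \<le> c n")
      case True
      then have "inf (Inf T) (p n) = bot"
        using none by blast
      moreover have "inf (Inf ?W) (p n) \<le> inf (Inf T) (p n)"
        by (intro inf_mono Inf_superset_mono order_refl) blast
      ultimately show ?thesis
        using le_bot by metis
    next
      case False
      then have "inf (Inf ?W) (p n) \<le> inf (Inf (N (c n))) (Sup (p ` Q (c n)))"
        using c[of n] by (intro inf_mono Inf_superset_mono Sup_upper) auto
      then show ?thesis
        using N(2) le_bot by metis
    qed
    then have "inf (Inf ?W) (Sup (range p)) = bot"
      by (intro inf_Sup_eq_bot) blast
    then show False
      using S(1) \<open>?W \<in> Fpow S\<close> Sup_partition[OF p] by (simp add: fip_def)
  qed
  then obtain h where h: "\<And>T m. T \<in> Fpow S \<Longrightarrow> m \<le> c (h T m) \<and> inf (Inf T) (p (h T m)) \<noteq> bot"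
    by metis
  have "\<not> dominating (h ` Fpow S)"
  proof
    assume "dominating (h ` Fpow S)"
    then have "dominating_number \<le>o |Fpow S|"
      using dominating_number_least card_of_image ordLeq_transitive by blast
    then show False
      using S(2) not_ordLess_ordLeq by blast
  qed
  then obtain f where "\<forall>T\<in>Fpow S. \<not> (\<forall>\<^sub>\<infinity>m. f m \<le> h T m)"
    unfolding dominating_def by blast
  then have f: "\<exists>m. h T m < f m" if "T \<in> Fpow S" for T
    using that MOST_I[of "\<lambda>m. f m \<le> h T m"] by (meson not_le)
  \<comment> \<open>Monotonicity matters because only \<open>m \<le> c (h T m)\<close> is known, not equality.\<close>
  define g where "g k = Max (f ` {..k})" for k
  define X where "X = {n. n \<le> g (c n)}"
  have "finite (X \<inter> Q k)" for k
  proof (rule finite_subset)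
    have "Q k = Q l" if "n \<in> Q k" "n \<in> Q l" for n l
      using Q that unfolding partition_on_def disjoint_def by blast
    then have "c n = (LEAST l. Q l = Q k)" if "n \<in> Q k" for n
      unfolding c_def using that by (metis (no_types, lifting))
    then show "X \<inter> Q k \<subseteq> {..g (LEAST l. Q l = Q k)}"
      unfolding X_def by fastforce
  qed simp
  moreover have "fip (insert (Sup (p ` X)) S)"
  proof (rule fip_insertI)
    fix T assume T: "T \<in> Fpow S"
    obtain m where m: "h T m < f m"
      using f[OF T] by blast
    have "f m \<le> g (c (h T m))"
      unfolding g_def using h[OF T] by (intro Max_ge) auto
    then have "p (h T m) \<le> Sup (p ` X)"
      using m by (intro Sup_upper) (simp add: X_def)
    then have "inf (Inf T) (p (h T m)) \<le> inf (Inf T) (Sup (p ` X))"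
      by (intro inf_mono order_refl)
    then show "inf (Inf T) (Sup (p ` X)) \<noteq> bot"
      using h[OF T] le_bot by metis
  qed
  ultimately show ?thesis
    unfolding decides_def by blast
qed

lemma fip_insert_top: "fip S \<Longrightarrow> fip (insert top S)"
  by (rule fip_insertI) (simp add: fip_def)

text \<open>
  A finite subset of the union is contained in a single stage, namely that of the largest index it
  involves.
\<close>

lemma fip_Union_stages:
  assumes D: "fip D" and J: "\<And>j. j \<in> J \<Longrightarrow> fip (insert (f j) (D \<union> f ` underS r j))"
    and r: "Well_order r" "J \<subseteq> Field r"
  shows "fip (D \<union> f ` J)"
  unfolding fip_def
proof
  fix T assume T: "T \<in> Fpow (D \<union> f ` J)"
  then have "finite (T \<inter> f ` J)"
    by (auto simp: Fpow_def)
  then obtain K where K: "K \<subseteq> J" "finite K" "T \<inter> f ` J = f ` K"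
    using finite_subset_image[of "T \<inter> f ` J" f J] by auto
  show "Inf T \<noteq> bot"
  proof (cases "K = {}")
    case True
    then have "T \<in> Fpow D"
      using T K by (auto simp: Fpow_def)
    then show ?thesis
      using D by (simp add: fip_def)
  next
    case False
    have "\<exists>j\<in>K. \<forall>i\<in>K. (i, j) \<in> r"
      using K(2) False K(1)
    proof (induction rule: finite_ne_induct)
      case (singleton j)
      then show ?case
        using r unfolding order_on_defs refl_on_def by blast
    next
      case (insert i K)
      then obtain j where j: "j \<in> K" "\<forall>i\<in>K. (i, j) \<in> r"
        by auto
      have "i \<in> Field r" "j \<in> Field r"
        using insert r j by auto
      then have "(i, j) \<in> r \<or> (j, i) \<in> r" "(i, i) \<in> r"
        using wo_rel.TOTALS[of r] r(1) by (auto simp: wo_rel_def)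
      moreover have "trans r"
        using wo_rel.TRANS[of r] r(1) by (simp add: wo_rel_def)
      ultimately show ?case
        using j by (blast dest: transD)
    qed
    then obtain j where j: "j \<in> K" "\<forall>i\<in>K. (i, j) \<in> r"
      by blast
    then have "K \<subseteq> insert j (underS r j)"
      by (auto simp: underS_def)
    then have "f ` K \<subseteq> insert (f j) (f ` underS r j)"
      by blast
    moreover have "T \<subseteq> D \<union> f ` K" "finite T"
      using T K(3) by (auto simp: Fpow_def)
    ultimately have "T \<in> Fpow (insert (f j) (D \<union> f ` underS r j))"
      unfolding Fpow_def by blast
    then show ?thesis
      using J[of j] j K by (auto simp: fip_def)
  qed
qed

text \<open>
  Stage \<open>a = (p, Q)\<close> adds one element that decides \<open>p\<close> and \<open>Q\<close>.  The stages are indexed by the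
  tasks themselves, well-ordered in type at most \<open>\<cc>\<close>, so that the set of earlier stages is always
  smaller than \<open>\<cc> = \<dd>\<close>.
\<close>

lemma fip_extends_to_coherent_P_ultrafilter:
  fixes D :: "'a::{boolean_algebra, complete_lattice} set"
  assumes cd: "continuum =o dominating_number" and card: "|UNIV :: 'a set| \<le>o continuum"
    and D: "fip D" "|D| <o continuum"
  shows "\<exists>U. D \<subseteq> U \<and> coherent_P_ultrafilter U"
proof -
  let ?r = "|UNIV :: ((nat \<Rightarrow> 'a) \<times> (nat \<Rightarrow> nat set)) set|"
  have wo: "Well_order ?r"
    by (rule card_of_Well_order)
  define task where "task = (\<lambda>(p :: nat \<Rightarrow> 'a, Q) x.
    ba_partition (range p) \<and> partition_on UNIV (range Q) \<longrightarrow> decides p Q x)"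
  define good where
    "good f a x \<longleftrightarrow> task a x \<and> fip (insert x (D \<union> f ` underS ?r a))" for f a x
  have stage: "\<exists>x. good f a x" if prev: "\<And>b. b \<in> underS ?r a \<Longrightarrow> good f b (f b)" for f a
  proof -
    let ?S = "D \<union> f ` underS ?r a"
    have S: "fip ?S"
      using D(1) prev wo by (intro fip_Union_stages[where r = ?r]) (auto simp: good_def Field_card_of)
    have "|underS ?r a| <o ?r"
      by (rule card_of_underS[OF card_of_Card_order]) (simp add: Field_card_of)
    then have "|f ` underS ?r a| <o continuum"
      using card_sequence_pairs_le_continuum[OF card] card_of_image
        ordLeq_ordLess_trans ordLess_ordLeq_trans by blast
    then have "|?S| <o continuum"
      using D(2) infinite_Field_continuum Card_order_continuum
      by (intro card_of_Un_ordLess_infinite_Field)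
    then have "|Fpow ?S| <o dominating_number"
      using Fpow_less_continuum cd ordLess_ordIso_trans by blast
    then show ?thesis
      using fip_extends_deciding[OF S] fip_insert_top[OF S]
      by (cases a) (auto simp: good_def task_def)
  qed
  \<comment> \<open>Transfinite recursion: the requirement at \<open>a\<close> involves \<open>f\<close> only on the predecessors of \<open>a\<close>.\<close>
  have "\<exists>f. \<forall>a. good f a (f a)"
  proof (rule dependent_wf_choice)
    show "wf (?r - Id)"
      using wo by (simp add: well_order_on_def)
    show "good f a x = good g a x" if "\<And>b. (b, a) \<in> ?r - Id \<Longrightarrow> f b = g b" for f g a x
    proof -
      have "f ` underS ?r a = g ` underS ?r a"
        using that by (intro image_cong) (auto simp: underS_def)
      then show ?thesis
        by (simp add: good_def)
    qed
    show "\<exists>x. good f a x" if "\<And>b. (b, a) \<in> ?r - Id \<Longrightarrow> good f b (f b)" for f a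
      using that by (intro stage) (auto simp: underS_def)
  qed
  then obtain f where f: "\<And>a. good f a (f a)"
    by blast
  have "fip (D \<union> range f)"
    using D(1) f wo by (intro fip_Union_stages[where r = ?r]) (auto simp: good_def Field_card_of)
  then obtain U where U: "ba_ultrafilter U" "D \<union> range f \<subseteq> U"
    using fip_extends_to_ultrafilter by blast
  have "P_ultrafilter {A. Sup (p ` A) \<in> U}" if p: "inj p" "ba_partition (range p)" for p
    unfolding P_ultrafilter_def
  proof (intro conjI allI impI)
    show "ba_ultrafilter {A. Sup (p ` A) \<in> U}"
      using U(1) p by (rule ba_ultrafilter_partition_trace)
    fix Q :: "nat \<Rightarrow> nat set" assume "partition_on UNIV (range Q)"
    then have "decides p Q (f (p, Q))"
      using f[of "(p, Q)"] p by (simp add: good_def task_def)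
    moreover have "f (p, Q) \<in> U"
      using U(2) by blast
    ultimately show "(\<exists>n. Q n \<in> {A. Sup (p ` A) \<in> U}) \<or>
        (\<exists>X\<in>{A. Sup (p ` A) \<in> U}. \<forall>n. finite (X \<inter> Q n))"
      unfolding decides_def by auto
  qed
  then show ?thesis
    using U unfolding coherent_P_ultrafilter_def by blast
qed


section \<open>A filter without coherent extension from a small dominating family\<close>

text \<open>
  The plane is encoded in the natural numbers because traces of ultrafilters are families of sets
  of natural numbers.
\<close>

definition region_above :: "nat \<Rightarrow> (nat \<Rightarrow> nat) \<Rightarrow> nat set" where
  "region_above m g = prod_encode ` {(k, j). m \<le> k \<and> g k < j}"

lemma region_above_mem [simp]: "prod_encode (k, j) \<in> region_above m g \<longleftrightarrow> m \<le> k \<and> g k < j"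
  by (auto simp: region_above_def prod_encode_eq)

text \<open>
  The regions are directed under reverse inclusion although \<open>D\<close> need not be closed under maxima:
  some member of \<open>D\<close> dominates \<open>max g1 g2\<close> from some column on, and the columns before that can be
  cut off.
\<close>

lemma region_above_subset_Int:
  assumes "dominating D"
  shows "\<exists>g\<in>D. \<exists>m. region_above m g \<subseteq> region_above m1 g1 \<inter> region_above m2 g2"
proof -
  obtain g where "g \<in> D" "\<forall>\<^sub>\<infinity>k. max (g1 k) (g2 k) \<le> g k"
    using assms unfolding dominating_def by (metis (no_types))
  moreover from this obtain m where "\<forall>k\<ge>m. max (g1 k) (g2 k) \<le> g k"
    unfolding MOST_nat_le by blast
  ultimately have "region_above (Max {m, m1, m2}) g \<subseteq> region_above m1 g1 \<inter> region_above m2 g2"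
    by (force simp: region_above_def)
  then show ?thesis
    using \<open>g \<in> D\<close> by blast
qed

text \<open>
  The partition into columns is the counterexample: \<open>region_above (Suc k) g\<close> avoids column \<open>k\<close>, and
  a set with finite columns lies, from some column on, below a member of \<open>D\<close>.
\<close>

lemma no_P_ultrafilter_contains_regions:
  assumes "dominating D" and above: "\<And>m g. g \<in> D \<Longrightarrow> region_above m g \<in> V"
  shows "\<not> P_ultrafilter V"
proof
  assume V: "P_ultrafilter V"
  then have F: "ba_filter V"
    by (simp add: P_ultrafilter_def ba_ultrafilter_def)
  have meet: "A \<inter> B \<noteq> {}" if "A \<in> V" "B \<in> V" for A B
    using F that unfolding ba_filter_def by (metis bot_set_def inf_set_def)
  define Q where "Q k = range (\<lambda>j. prod_encode (k, j))" for k
  have "\<exists>k j. n = prod_encode (k, j)" for n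
    by (metis prod_decode_inverse surj_pair)
  then have "\<Union> (range Q) = UNIV"
    unfolding Q_def by blast
  then have "partition_on UNIV (range Q)"
    unfolding partition_on_def disjoint_def by (auto simp: Q_def prod_encode_eq)
  then consider k where "Q k \<in> V" | X where "X \<in> V" "\<And>k. finite (X \<inter> Q k)"
    using V unfolding P_ultrafilter_def by metis
  then show False
  proof cases
    case 1
    obtain g where "g \<in> D"
      using assms(1) unfolding dominating_def by blast
    moreover have "Q k \<inter> region_above (Suc k) g = {}"
      by (auto simp: Q_def)
    ultimately show False
      using 1 above meet by metis
  next
    case 2
    have "\<exists>b. \<forall>j. prod_encode (k, j) \<in> X \<longrightarrow> j \<le> b" for k
    proof -
      have "finite ((\<lambda>j. prod_encode (k, j)) -` (X \<inter> Q k))"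
        using 2(2) by (intro finite_vimageI) (auto simp: inj_def prod_encode_eq)
      moreover have "(\<lambda>j. prod_encode (k, j)) -` (X \<inter> Q k) = {j. prod_encode (k, j) \<in> X}"
        by (auto simp: Q_def)
      ultimately show ?thesis
        using finite_nat_set_iff_bounded_le by auto
    qed
    then obtain f where f: "\<And>k j. prod_encode (k, j) \<in> X \<Longrightarrow> j \<le> f k"
      by metis
    obtain g where g: "g \<in> D" "\<forall>\<^sub>\<infinity>k. f k \<le> g k"
      using assms(1) unfolding dominating_def by blast
    then obtain m where "\<forall>k\<ge>m. f k \<le> g k"
      unfolding MOST_nat_le by blast
    then have "X \<inter> region_above m g = {}"
      using f by (fastforce simp: region_above_def)
    then show False
      using 2(1) above[OF g(1)] meet by blast
  qed
qed

text \<open>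
  The filter consists of the elements above the join of some region.  Its base is indexed by a
  column number and a member of \<open>D\<close>, so it is still smaller than \<open>\<cc>\<close>.
\<close>

lemma small_dominating_family_blocks_extension:
  fixes p :: "nat \<Rightarrow> 'a::{boolean_algebra, complete_lattice}"
  assumes D: "dominating D" "|D| <o continuum" and p: "inj p" "ba_partition (range p)"
  shows "\<exists>F :: 'a set. ba_filter F \<and> (\<exists>B. filter_base B F \<and> |B| <o continuum) \<and>
           (\<nexists>U. F \<subseteq> U \<and> coherent_P_ultrafilter U)"
proof (intro exI conjI)
  let ?x = "\<lambda>(m, g). Sup (p ` region_above m g)"
  let ?B = "?x ` (UNIV \<times> D)"
  let ?F = "{y. \<exists>b\<in>?B. b \<le> y}"
  have meet: "inf x y \<in> ?F" if xy: "x \<in> ?F" "y \<in> ?F" for x y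
  proof -
    obtain m1 g1 m2 g2 where "Sup (p ` region_above m1 g1) \<le> x" "Sup (p ` region_above m2 g2) \<le> y"
      using xy by auto
    moreover obtain g m where "g \<in> D" "region_above m g \<subseteq> region_above m1 g1 \<inter> region_above m2 g2"
      using region_above_subset_Int[OF D(1)] by metis
    then have "Sup (p ` region_above m g) \<le> Sup (p ` region_above m1 g1)"
      "Sup (p ` region_above m g) \<le> Sup (p ` region_above m2 g2)" "?x (m, g) \<in> ?B"
      by (auto intro!: Sup_subset_mono)
    ultimately have "?x (m, g) \<in> ?B" "?x (m, g) \<le> inf x y"
      by (auto intro: order_trans)
    then show ?thesis
      by blast
  qed
  have "bot \<notin> ?F"
  proof
    assume "bot \<in> ?F"
    then obtain m g where bot: "Sup (p ` region_above m g) \<le> bot"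
      by auto
    have "p (prod_encode (m, Suc (g m))) \<le> Sup (p ` region_above m g)"
      by (intro Sup_upper imageI) simp
    then have "p (prod_encode (m, Suc (g m))) = bot"
      using bot le_bot order_trans by metis
    then show False
      using p(2) unfolding ba_partition_def antichain_def by (metis rangeI)
  qed
  moreover obtain g where "g \<in> D"
    using D(1) unfolding dominating_def by blast
  then have "top \<in> ?F"
    by auto
  ultimately show "ba_filter ?F"
    using meet unfolding ba_filter_def by (blast intro: order_trans)
  show "filter_base ?B ?F"
    unfolding filter_base_def by blast
  have "|(UNIV :: nat set) \<times> D| <o continuum"
    using D(2) by (rule nat_Times_less_continuum)
  then show "|?B| <o continuum"
    using card_of_image ordLeq_ordLess_trans by blast
  show "\<nexists>U. ?F \<subseteq> U \<and> coherent_P_ultrafilter U"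
  proof
    assume "\<exists>U. ?F \<subseteq> U \<and> coherent_P_ultrafilter U"
    then obtain U where U: "?F \<subseteq> U" "coherent_P_ultrafilter U"
      by blast
    have "region_above m g \<in> {A. Sup (p ` A) \<in> U}" if "g \<in> D" for m g
      using U(1) that by auto
    then have "\<not> P_ultrafilter {A. Sup (p ` A) \<in> U}"
      using no_P_ultrafilter_contains_regions[OF D(1)] by blast
    then show False
      using U(2) p unfolding coherent_P_ultrafilter_def by blast
  qed
qed


section \<open>The equivalence\<close>

theorem proposition3p4:
  assumes "infinite (UNIV :: 'a::{boolean_algebra, complete_lattice} set)"
    and "ccc TYPE('a)"
    and "|UNIV :: 'a set| \<le>o continuum"
  shows "(\<forall>F :: 'a set. ba_filter F \<and> (\<exists>D. filter_base D F \<and> |D| <o continuum) \<longrightarrow>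
            (\<exists>U. F \<subseteq> U \<and> coherent_P_ultrafilter U))
         \<longleftrightarrow> continuum =o dominating_number"
proof
  assume extend: "\<forall>F :: 'a set. ba_filter F \<and> (\<exists>D. filter_base D F \<and> |D| <o continuum) \<longrightarrow>
            (\<exists>U. F \<subseteq> U \<and> coherent_P_ultrafilter U)"
  obtain p :: "nat \<Rightarrow> 'a" where p: "inj p" "ba_partition (range p)"
    using exists_infinite_partition[OF assms(1)] by blast
  obtain D where D: "dominating D" "|D| =o dominating_number"
    using dominating_number_attained by blast
  have "\<not> |D| <o continuum"
    using small_dominating_family_blocks_extension[OF D(1) _ p] extend by blast
  then have "continuum \<le>o |D|"
    using Card_order_continuum card_of_Card_order not_ordLess_iff_ordLeq
      card_order_on_well_order_on card_of_Well_order by blast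
  then show "continuum =o dominating_number"
    using D(2) dominating_number_le_continuum ordIso_iff_ordLeq ordLeq_ordIso_trans by blast
next
  assume cd: "continuum =o dominating_number"
  show "\<forall>F :: 'a set. ba_filter F \<and> (\<exists>D. filter_base D F \<and> |D| <o continuum) \<longrightarrow>
            (\<exists>U. F \<subseteq> U \<and> coherent_P_ultrafilter U)"
  proof (intro allI impI)
    fix F :: "'a set" assume "ba_filter F \<and> (\<exists>D. filter_base D F \<and> |D| <o continuum)"
    then obtain D where F: "ba_filter F" and D: "filter_base D F" "|D| <o continuum"
      by blast
    have "fip D"
      using fip_ba_filter[OF F] D(1) fip_subset unfolding filter_base_def by blast
    then obtain U where U: "D \<subseteq> U" "coherent_P_ultrafilter U"
      using fip_extends_to_coherent_P_ultrafilter[OF cd assms(3) _ D(2)] by blast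
    have "ba_filter U"
      using U(2) by (simp add: coherent_P_ultrafilter_def ba_ultrafilter_def)
    then have "F \<subseteq> U"
      using D(1) U(1) unfolding filter_base_def ba_filter_def by blast
    then show "\<exists>U. F \<subseteq> U \<and> coherent_P_ultrafilter U"
      using U(2) by blast
  qed
qed

end
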